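(* There exists an almost disjoint family $\mathcal{Q}$ of infinite subsets of a countably infinite set with $|\mathcal{Q}| = \mathfrak{b}$ such that $\mathcal{Q}$ is not an almost disjoint refinement of $\mathcal{T}_1 \cup \mathcal{T}_2$ for any two orthogonal towers $\mathcal{T}_1=\{A_\alpha:\alpha<\mathfrak{b}\}$ and $\mathcal{T}_2=\{C_\alpha:\alpha<\mathfrak{b}\}$, each of cardinality $\mathfrak{b}$.
   Context: $\mathfrak{b}$ denotes the least cardinality of a family of functions $f:\omega\to\omega$ that is unbounded with respect to $\leq^*$, where $f\leq^* g$ means $f(n)\leq g(n)$ for all but finitely many $n$. For sets $A,B$, $A$ is almost contained in $B$ if $A\setminus B$ is finite; $A\subset^* B$ means $A$ is almost contained in $B$ but $B$ is not almost contained in $A$. Sets are almost disjoint if their intersection is finite. An almost disjoint (AD) family is a family of infinite sets any two distinct members of which are almost disjoint. A family $\{A_\alpha:\alpha<\lambda\}$ is a tower if $\alpha<\beta$ implies $A_\alpha\subset^* A_\beta$. Two families $\mathcal{Q},\mathcal{H}$ are orthogonal if every $A\in\mathcal{Q}$ and $B\in\mathcal{H}$ are almost disjoint. An AD-family $\mathcal{Q}$ is an almost disjoint refinement (ADR) of a family $\mathcal{P}$ if there is a bijection $f:\mathcal{Q}\to\mathcal{P}$ with $X$ almost contained in $f(X)$ for every $X\in\mathcal{Q}$. *)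

theory Defs
  imports "HOL-Library.Countable_Set"
begin

unbundle cardinal_syntax

definition eventually_dominated :: "(nat \<Rightarrow> nat) \<Rightarrow> (nat \<Rightarrow> nat) \<Rightarrow> bool"
    (infix "\<le>\<^sup>*" 50)
  where "f \<le>\<^sup>* g \<longleftrightarrow> finite {n. \<not> f n \<le> g n}"

definition unbounded_family :: "(nat \<Rightarrow> nat) set \<Rightarrow> bool"
  where "unbounded_family F \<longleftrightarrow> \<not> (\<exists>g. \<forall>f\<in>F. f \<le>\<^sup>* g)"

text \<open>
  Cardinals are well-orders that are minimal on their field, as in the BNF cardinal library.
  The representative chosen here is unique up to order isomorphism, and its field,
  ordered by the relation, plays the role of the set of ordinals below the bounding number.
\<close>

definition bounding_number :: "(nat \<Rightarrow> nat) rel" ("\<bb>")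
  where "\<bb> = (SOME r. (\<exists>F. unbounded_family F \<and> r = |F| ) \<and>
                      (\<forall>G. unbounded_family G \<longrightarrow> r \<le>o |G| ))"

lemma unbounded_family_UNIV: "unbounded_family UNIV"
proof -
  have "\<not> (\<lambda>n. Suc (g n)) \<le>\<^sup>* g" for g
    by (simp add: eventually_dominated_def)
  then show ?thesis
    unfolding unbounded_family_def by blast
qed

lemma bounding_number_spec:
  "(\<exists>F. unbounded_family F \<and> \<bb> = |F| ) \<and> (\<forall>G. unbounded_family G \<longrightarrow> \<bb> \<le>o |G| )"
proof -
  let ?R = "card_of ` Collect unbounded_family"
  have "?R \<noteq> {}" "\<forall>r\<in>?R. Card_order r"
    using unbounded_family_UNIV by (auto simp: card_of_Card_order)
  then have "\<exists>r\<in>?R. \<forall>r'\<in>?R. r \<le>o r'"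
    by (rule exists_minim_Card_order)
  then have "\<exists>r. (\<exists>F. unbounded_family F \<and> r = |F| ) \<and> (\<forall>G. unbounded_family G \<longrightarrow> r \<le>o |G| )"
    by blast
  then show ?thesis
    unfolding bounding_number_def by (rule someI_ex)
qed

lemma Card_order_bounding_number: "Card_order \<bb>"
  using bounding_number_spec card_of_Card_order by metis

definition almost_contained :: "'a set \<Rightarrow> 'a set \<Rightarrow> bool" (infix "\<subseteq>\<^sup>*" 50)
  where "A \<subseteq>\<^sup>* B \<longleftrightarrow> finite (A - B)"

definition strictly_almost_contained :: "'a set \<Rightarrow> 'a set \<Rightarrow> bool" (infix "\<subset>\<^sup>*" 50)
  where "A \<subset>\<^sup>* B \<longleftrightarrow> A \<subseteq>\<^sup>* B \<and> \<not> B \<subseteq>\<^sup>* A"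

definition almost_disjoint :: "'a set \<Rightarrow> 'a set \<Rightarrow> bool"
  where "almost_disjoint A B \<longleftrightarrow> finite (A \<inter> B)"

definition AD_family :: "'a set set \<Rightarrow> bool"
  where "AD_family Q \<longleftrightarrow>
    (\<forall>X\<in>Q. infinite X) \<and> (\<forall>X\<in>Q. \<forall>Y\<in>Q. X \<noteq> Y \<longrightarrow> almost_disjoint X Y)"

text \<open>
  The index ordinal is given by a well-order \<open>r\<close>; since \<open>r\<close> is reflexive,
  \<open>\<alpha> < \<beta>\<close> is membership of the pair in \<open>r\<close> together with \<open>\<alpha> \<noteq> \<beta>\<close>.
  Values of \<open>A\<close> outside the field of \<open>r\<close> are irrelevant.
\<close>

definition tower :: "'i rel \<Rightarrow> ('i \<Rightarrow> 'a set) \<Rightarrow> bool"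
  where "tower r A \<longleftrightarrow> (\<forall>\<alpha> \<beta>. (\<alpha>, \<beta>) \<in> r \<and> \<alpha> \<noteq> \<beta> \<longrightarrow> A \<alpha> \<subset>\<^sup>* A \<beta>)"

definition orthogonal_families :: "'a set set \<Rightarrow> 'a set set \<Rightarrow> bool"
  where "orthogonal_families Q H \<longleftrightarrow> (\<forall>A\<in>Q. \<forall>B\<in>H. almost_disjoint A B)"

definition AD_refinement :: "'a set set \<Rightarrow> 'a set set \<Rightarrow> bool"
  where "AD_refinement Q P \<longleftrightarrow>
    AD_family Q \<and> (\<exists>f. bij_betw f Q P \<and> (\<forall>X\<in>Q. X \<subseteq>\<^sup>* f X))"

end

theory Submission
  imports Defs
begin

text \<open>
  Take a scale: strictly increasing functions \<open>s \<alpha>\<close>, \<open>\<alpha> < \<bb>\<close>, strictly increasing modulo finite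
  and unbounded. Let \<open>Q\<close> consist of the columns of a copy of \<open>\<omega> \<times> \<omega>\<close> and of the graphs of
  the \<open>s \<alpha>\<close>. If \<open>Q\<close> refined the union of two orthogonal towers, one of them, say the first, would
  be assigned infinitely many columns; since \<open>\<bb>\<close> has uncountable cofinality, a single member
  of it almost contains all of these. That member is almost disjoint from the \<open>\<bb>\<close> many graphs assigned
  to the second tower, which bounds cofinally many \<open>s \<alpha>\<close> on an infinite set of columns and hence,
  by monotonicity, bounds the whole scale.
\<close>

section \<open>Eventual domination and the size of \<open>\<bb>\<close>\<close>

lemma eventually_dominated_trans:
  assumes "f \<le>\<^sup>* g" "g \<le>\<^sup>* h"
  shows "f \<le>\<^sup>* h"
proof -
  have "{n. \<not> f n \<le> h n} \<subseteq> {n. \<not> f n \<le> g n} \<union> {n. \<not> g n \<le> h n}"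
    by auto
  then show ?thesis
    using assms unfolding eventually_dominated_def by (meson finite_UnI finite_subset)
qed

lemma eventually_dominated_if_le: "(\<And>n. f n \<le> g n) \<Longrightarrow> f \<le>\<^sup>* g"
  by (simp add: eventually_dominated_def)

text \<open>Diagonalisation. It makes \<open>\<bb>\<close> uncountable and, once a scale is
  available, gives it uncountable cofinality.\<close>

lemma countable_not_unbounded_family:
  assumes "countable F"
  shows "\<not> unbounded_family F"
proof (cases "F = {}")
  case True
  then show ?thesis by (simp add: unbounded_family_def)
next
  case False
  define e where "e = from_nat_into F"
  have F: "F = range e"
    using assms False by (simp add: e_def range_from_nat_into)
  \<comment> \<open>The sum at \<open>n\<close> contains the term \<open>e i n\<close> for every
    \<open>i \<le> n\<close>, so \<open>g\<close> can fail to bound \<open>e i\<close> only below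
    \<open>i\<close>.\<close>
  define g where "g n = (\<Sum>i\<le>n. e i n)" for n
  have "e i \<le>\<^sup>* g" for i
  proof -
    have "e i n \<le> g n" if "i \<le> n" for n
      unfolding g_def using that by (intro member_le_sum) auto
    then have "{n. \<not> e i n \<le> g n} \<subseteq> {..<i}"
      using not_le by blast
    then show ?thesis
      unfolding eventually_dominated_def using finite_subset by blast
  qed
  then show ?thesis
    unfolding unbounded_family_def F by blast
qed

lemma card_less_not_unbounded_family: "|G| <o \<bb> \<Longrightarrow> \<not> unbounded_family G"
  using bounding_number_spec not_ordLess_ordLeq by blast

text \<open>As \<open>\<bb>\<close> is chosen of the form \<open>|F|\<close> with \<open>F\<close>
  unbounded, its field is \<open>F\<close> itself. The ordinals below \<open>\<bb>\<close> are thus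
  functions, and together they form an unbounded family; the scale exploits this double
  role.\<close>

lemma Field_bounding_number:
  "unbounded_family (Field \<bb>)" "|Field \<bb>| = \<bb>"
  using bounding_number_spec Field_card_of by metis+

lemma infinite_Field_bounding_number: "infinite (Field \<bb>)"
  using Field_bounding_number countable_not_unbounded_family countable_finite by blast

lemma countable_card_less_bounding_number: "countable X \<Longrightarrow> |X| <o \<bb>"
proof -
  assume "countable X"
  have "\<not> \<bb> \<le>o |X|"
  proof
    assume "\<bb> \<le>o |X|"
    then have "|Field \<bb>| \<le>o |X|"
      using Field_bounding_number(2) by simp
    then have "countable (Field \<bb>)"
      using \<open>countable X\<close> card_of_ordLeq countable_image_inj_on countable_subset by metis
    then show False
      using Field_bounding_number(1) countable_not_unbounded_family by blast
  qed
  then show ?thesis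
    using Card_order_bounding_number card_of_Card_order not_ordLeq_iff_ordLess
    by (metis card_order_on_well_order_on)
qed

section \<open>Construction of a scale\<close>

lemma exists_strict_mono_above:
  fixes f g :: "nat \<Rightarrow> nat"
  obtains r where "strict_mono r" "\<And>n. f n \<le> r n" "\<And>n. g n < r n"
proof -
  \<comment> \<open>The last summand alone exceeds \<open>g n\<close> and is at least
    \<open>f n\<close>; the 1 in each summand makes the partial sums strictly increasing.\<close>
  define r where "r n = (\<Sum>i\<le>n. f i + g i + 1)" for n
  have ge: "f n + g n + 1 \<le> r n" for n
    unfolding r_def by (rule member_le_sum) auto
  show thesis
  proof (rule that[of r])
    show "strict_mono r"
      by (simp add: strict_mono_Suc_iff r_def)
    show "f n \<le> r n" "g n < r n" for n
      using ge[of n] by linarith+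
  qed
qed

text \<open>An index \<open>h\<close> is itself a function and lies below its own value
  \<open>s h\<close>. Hence unboundedness of the scale need not be demanded: it is inherited from
  the indices in \<open>Field \<bb>\<close>.\<close>

definition scale :: "((nat \<Rightarrow> nat) \<Rightarrow> nat \<Rightarrow> nat) \<Rightarrow> bool" where
  "scale s \<longleftrightarrow> (\<forall>h. strict_mono (s h)) \<and> (\<forall>h n. h n \<le> s h n) \<and>
    (\<forall>h h'. (h', h) \<in> \<bb> \<and> h' \<noteq> h \<longrightarrow> finite {n. s h n \<le> s h' n})"

lemma scaleD:
  assumes "scale s"
  shows "strict_mono (s h)" "h n \<le> s h n"
    "(h', h) \<in> \<bb> \<Longrightarrow> h' \<noteq> h \<Longrightarrow> finite {n. s h n \<le> s h' n}"
  using assms by (simp_all add: scale_def)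

text \<open>Recursion along \<open>\<bb>\<close>: an index has fewer than \<open>\<bb>\<close>
  predecessors, so the functions chosen before it have a common bound, and any strictly increasing
  function above that bound and above the index can come next.\<close>

lemma exists_scale: "\<exists>s. scale s"
proof -
  \<comment> \<open>\<open>r\<close> is an admissible value at \<open>h\<close>, given the values of
    \<open>s\<close> at the predecessors of \<open>h\<close>.\<close>
  define P where "P s h r \<longleftrightarrow> strict_mono r \<and> (\<forall>n. h n \<le> r n) \<and>
      (\<forall>h'. (h', h) \<in> \<bb> - Id \<longrightarrow> finite {n. r n \<le> s h' n})"
    for s :: "(nat \<Rightarrow> nat) \<Rightarrow> nat \<Rightarrow> nat" and h r :: "nat \<Rightarrow> nat"
  have wf: "wf (\<bb> - Id)"
    using Card_order_bounding_number by (simp add: card_order_on_def well_order_on_def)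
  have "\<exists>s. \<forall>h. P s h (s h)"
  proof (rule dependent_wf_choice[OF wf])
    fix s t :: "(nat \<Rightarrow> nat) \<Rightarrow> nat \<Rightarrow> nat" and h r :: "nat \<Rightarrow> nat"
    assume "\<And>z. (z, h) \<in> \<bb> - Id \<Longrightarrow> s z = t z"
    then show "P s h r = P t h r"
      by (auto simp: P_def)
  next
    fix h :: "nat \<Rightarrow> nat" and s :: "(nat \<Rightarrow> nat) \<Rightarrow> nat \<Rightarrow> nat"
    have "|s ` underS \<bb> h| <o \<bb>"
    proof (cases "h \<in> Field \<bb>")
      case True
      then show ?thesis
        using card_of_image card_of_underS[OF Card_order_bounding_number True]
          ordLeq_ordLess_trans by blast
    next
      \<comment> \<open>Since \<open>s\<close> is total, the recursion also visits functions off the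
        field; these have no predecessors.\<close>
      case False
      then have "underS \<bb> h = {}"
        by (auto simp: underS_def Field_def)
      then show ?thesis
        by (simp add: countable_card_less_bounding_number)
    qed
    then obtain g where g: "\<And>h'. h' \<in> underS \<bb> h \<Longrightarrow> s h' \<le>\<^sup>* g"
      using card_less_not_unbounded_family unfolding unbounded_family_def by blast
    obtain r where r: "strict_mono r" "\<And>n. h n \<le> r n" "\<And>n. g n < r n"
      using exists_strict_mono_above by blast
    have "finite {n. r n \<le> s h' n}" if "(h', h) \<in> \<bb> - Id" for h'
    proof -
      have "{n. r n \<le> s h' n} \<subseteq> {n. \<not> s h' n \<le> g n}"
        using r(3) by (auto simp: not_le intro: less_le_trans)
      moreover have "finite {n. \<not> s h' n \<le> g n}"
        using g[of h'] that by (auto simp: underS_def eventually_dominated_def)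
      ultimately show ?thesis
        by (rule finite_subset)
    qed
    then show "\<exists>r. P s h r"
      using r unfolding P_def by blast
  qed
  then show ?thesis
    unfolding P_def scale_def by blast
qed

section \<open>Cofinal sets of indices\<close>

definition cofinal_in :: "'i rel \<Rightarrow> 'i set \<Rightarrow> bool" where
  "cofinal_in r B \<longleftrightarrow> B \<subseteq> Field r \<and> (\<forall>x\<in>Field r. \<exists>y\<in>B. (x, y) \<in> r)"

lemma not_cofinal_in_bound:
  assumes "Well_order r" "B \<subseteq> Field r" "\<not> cofinal_in r B"
  obtains x where "x \<in> Field r" "B \<subseteq> underS r x"
proof -
  obtain x where x: "x \<in> Field r" "\<And>y. y \<in> B \<Longrightarrow> (x, y) \<notin> r"
    using assms unfolding cofinal_in_def by blast
  have "y \<in> underS r x" if "y \<in> B" for y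
    using wo_rel.TOTALS[of r] wo_rel.intro[OF assms(1)] x that assms(2)
    unfolding underS_def by blast
  then show thesis
    using that x(1) by blast
qed

text \<open>A set that is not cofinal lies in a proper initial segment, and in a cardinal order
  these have smaller cardinality. Used to see that a set of indices which is not too small is
  cofinal.\<close>

lemma not_cofinal_in_card_less:
  assumes "Card_order r" "B \<subseteq> Field r" "\<not> cofinal_in r B"
  shows "|B| <o r"
proof -
  have "Well_order r"
    using assms(1) by (rule card_order_on_well_order_on)
  then obtain x where "x \<in> Field r" "B \<subseteq> underS r x"
    using assms(2,3) by (rule not_cofinal_in_bound)
  then show ?thesis
    using card_of_underS[OF assms(1)] ordLeq_ordLess_trans[OF card_of_mono1] by blast
qed

text \<open>A bound for the functions indexed by \<open>B\<close> would bound every \<open>h\<close>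
  in the field, because \<open>h \<le>\<^sup>* s h \<le>\<^sup>* s h'\<close> for some
  \<open>h'\<close> in \<open>B\<close> at or above \<open>h\<close>. But the field is an unbounded
  family.\<close>

lemma scale_cofinal_unbounded:
  assumes "scale s" "cofinal_in \<bb> B"
  shows "unbounded_family (s ` B)"
proof -
  have "\<exists>h'\<in>B. h \<le>\<^sup>* s h'" if h: "h \<in> Field \<bb>" for h
  proof -
    obtain h' where h': "h' \<in> B" "(h, h') \<in> \<bb>"
      using assms(2) h unfolding cofinal_in_def by blast
    have "s h \<le>\<^sup>* s h'"
    proof (cases "h = h'")
      case True
      then show ?thesis by (simp add: eventually_dominated_def)
    next
      case False
      then have "finite {n. s h' n \<le> s h n}"
        using scaleD(3)[OF assms(1)] h' by blast
      then show ?thesis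
        unfolding eventually_dominated_def by (rule rev_finite_subset) auto
    qed
    moreover have "h \<le>\<^sup>* s h"
      using scaleD(2)[OF assms(1)] by (rule eventually_dominated_if_le)
    ultimately have "h \<le>\<^sup>* s h'"
      by (rule eventually_dominated_trans[rotated])
    then show ?thesis
      using h' by blast
  qed
  then have "\<forall>h\<in>Field \<bb>. h \<le>\<^sup>* g" if "\<forall>f\<in>s ` B. f \<le>\<^sup>* g" for g
    using that by (meson eventually_dominated_trans imageI)
  moreover have "\<nexists>g. \<forall>h\<in>Field \<bb>. h \<le>\<^sup>* g"
    using Field_bounding_number(1) unfolding unbounded_family_def .
  ultimately show ?thesis
    unfolding unbounded_family_def by metis
qed

text \<open>Uncountable cofinality of \<open>\<bb>\<close>: along a cofinal set of indices a scale
  is unbounded, which no countable family is.\<close>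

lemma countable_bound_in_bounding_number:
  assumes "countable B" "B \<subseteq> Field \<bb>"
  obtains h where "h \<in> Field \<bb>" "\<And>b. b \<in> B \<Longrightarrow> (b, h) \<in> \<bb>"
proof -
  obtain s where "scale s"
    using exists_scale by blast
  then have "\<not> cofinal_in \<bb> B"
    using scale_cofinal_unbounded countable_not_unbounded_family[of "s ` B"] assms(1) by auto
  then obtain h where "h \<in> Field \<bb>" "B \<subseteq> underS \<bb> h"
    using not_cofinal_in_bound[of \<bb> B] assms(2) Card_order_bounding_number
      card_order_on_well_order_on by metis
  then show thesis
    using that unfolding underS_def by blast
qed

section \<open>Columns, graphs and bounds on infinitely many columns\<close>

definition column :: "(nat \<times> nat \<Rightarrow> 'a) \<Rightarrow> nat \<Rightarrow> 'a set" where
  "column e n = e ` ({n} \<times> UNIV)"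

definition graph_image :: "(nat \<times> nat \<Rightarrow> 'a) \<Rightarrow> (nat \<Rightarrow> nat) \<Rightarrow> 'a set" where
  "graph_image e f = (\<lambda>n. e (n, f n)) ` UNIV"

text \<open>Let \<open>g n\<close> be a height from which column \<open>n\<close> lies inside
  \<open>A\<close>. A graph reaching this height at infinitely many columns of \<open>I\<close>
  would meet \<open>A\<close> in infinitely many points. The choice of \<open>g\<close> depends on
  \<open>A\<close> only, so it serves all \<open>f\<close> at once.\<close>

lemma dominated_on_columns:
  assumes e: "inj e"
    and columns: "\<And>n. n \<in> I \<Longrightarrow> column e n \<subseteq>\<^sup>* A"
  obtains g where "\<And>f. almost_disjoint A (graph_image e f) \<Longrightarrow> finite {n \<in> I. g n \<le> f n}"
proof -
  have "\<exists>m. \<forall>k\<ge>m. e (n, k) \<in> A" if "n \<in> I" for n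
  proof -
    have "finite {k. e (n, k) \<notin> A}"
    proof (rule finite_imageD)
      have "(\<lambda>k. e (n, k)) ` {k. e (n, k) \<notin> A} \<subseteq> column e n - A"
        by (auto simp: column_def)
      then show "finite ((\<lambda>k. e (n, k)) ` {k. e (n, k) \<notin> A})"
        using columns[OF that] finite_subset unfolding almost_contained_def by blast
      show "inj_on (\<lambda>k. e (n, k)) {k. e (n, k) \<notin> A}"
        using e by (auto simp: inj_on_def)
    qed
    then obtain m where "\<forall>k\<in>{k. e (n, k) \<notin> A}. k < m"
      using finite_nat_set_iff_bounded by auto
    then have "\<forall>k\<ge>m. e (n, k) \<in> A"
      by (auto simp: not_less[symmetric])
    then show ?thesis ..
  qed
  then obtain g where g: "\<And>n k. n \<in> I \<Longrightarrow> g n \<le> k \<Longrightarrow> e (n, k) \<in> A"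
    by metis
  have "finite {n \<in> I. g n \<le> f n}" if "almost_disjoint A (graph_image e f)" for f
  proof (rule finite_imageD)
    have "(\<lambda>n. e (n, f n)) ` {n \<in> I. g n \<le> f n} \<subseteq> A \<inter> graph_image e f"
      using g by (auto simp: graph_image_def)
    then show "finite ((\<lambda>n. e (n, f n)) ` {n \<in> I. g n \<le> f n})"
      using that finite_subset unfolding almost_disjoint_def by blast
    show "inj_on (\<lambda>n. e (n, f n)) {n \<in> I. g n \<le> f n}"
      using e by (auto simp: inj_on_def)
  qed
  then show thesis
    using that by blast
qed

text \<open>Monotonicity carries a bound on \<open>I\<close> to all arguments: if
  \<open>nxt n\<close> is an element of \<open>I\<close> at or beyond \<open>n\<close>, then
  \<open>f n \<le> f (nxt n) < g (nxt n)\<close> for large \<open>n\<close>. How large depends on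
  \<open>f\<close>, but the bound does not.\<close>

lemma mono_bounded_on_infinite:
  assumes "infinite I" "\<And>f. f \<in> F \<Longrightarrow> mono f"
    and "\<And>f. f \<in> F \<Longrightarrow> finite {n \<in> I. g n \<le> f n}"
  shows "\<not> unbounded_family F"
proof -
  have "\<exists>m. m \<in> I \<and> n \<le> m" for n :: nat
    using assms(1) by (meson infinite_nat_iff_unbounded_le)
  then obtain nxt where nxt: "\<And>n. nxt n \<in> I \<and> n \<le> nxt n"
    by metis
  have "f \<le>\<^sup>* (\<lambda>n. g (nxt n))" if f: "f \<in> F" for f
  proof -
    obtain N where N: "\<And>n. n \<in> I \<Longrightarrow> g n \<le> f n \<Longrightarrow> n < N"
      using assms(3)[OF f] unfolding finite_nat_set_iff_bounded by blast
    have "f n \<le> g (nxt n)" if "N \<le> n" for n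
    proof -
      have "f n \<le> f (nxt n)"
        using assms(2)[OF f] nxt monoD by blast
      moreover have "f (nxt n) < g (nxt n)"
        using N[of "nxt n"] nxt[of n] that by linarith
      ultimately show ?thesis by simp
    qed
    then have "{n. \<not> f n \<le> g (nxt n)} \<subseteq> {..<N}"
      by (auto simp: not_le[symmetric])
    then show ?thesis
      unfolding eventually_dominated_def using finite_subset by blast
  qed
  then show ?thesis
    unfolding unbounded_family_def by blast
qed

section \<open>The almost disjoint family of columns and graphs\<close>

definition columns_and_graphs ::
  "(nat \<times> nat \<Rightarrow> 'a) \<Rightarrow> ((nat \<Rightarrow> nat) \<Rightarrow> nat \<Rightarrow> nat) \<Rightarrow> 'a set set" where
  "columns_and_graphs e s = range (column e) \<union> (\<lambda>h. graph_image e (s h)) ` Field \<bb>"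

lemma infinite_column: "inj e \<Longrightarrow> infinite (column e n)"
  unfolding column_def by (simp add: finite_image_iff finite_cartesian_product_iff inj_on_subset)

lemma infinite_graph_image: "inj e \<Longrightarrow> infinite (graph_image e f)"
  unfolding graph_image_def by (subst finite_image_iff) (auto simp: inj_on_def)

lemma almost_disjoint_sym: "almost_disjoint A B \<Longrightarrow> almost_disjoint B A"
  by (simp add: almost_disjoint_def Int_commute)

lemma almost_disjoint_columns:
  assumes "inj e" "m \<noteq> n"
  shows "almost_disjoint (column e m) (column e n)"
proof -
  have "column e m \<inter> column e n = {}"
    using assms by (auto simp: column_def inj_def)
  then show ?thesis by (simp add: almost_disjoint_def)
qed

lemma almost_disjoint_column_graph:
  assumes "inj e"
  shows "almost_disjoint (column e n) (graph_image e f)"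
proof -
  have "column e n \<inter> graph_image e f \<subseteq> {e (n, f n)}"
    using assms by (auto simp: column_def graph_image_def inj_def)
  then show ?thesis
    unfolding almost_disjoint_def using finite_subset by blast
qed

lemma almost_disjoint_graphs:
  assumes "inj e" "finite {n. f n = g n}"
  shows "almost_disjoint (graph_image e f) (graph_image e g)"
proof -
  have "graph_image e f \<inter> graph_image e g \<subseteq> (\<lambda>n. e (n, f n)) ` {n. f n = g n}"
    using assms(1) by (force simp: graph_image_def inj_def)
  then show ?thesis
    unfolding almost_disjoint_def using assms(2) finite_subset by blast
qed

text \<open>One of the two indices precedes the other, so its function is eventually strictly
  smaller and the two agree at finitely many arguments only.\<close>

lemma almost_disjoint_scale_graphs:
  assumes "inj e" "scale s" "h \<in> Field \<bb>" "h' \<in> Field \<bb>" "h \<noteq> h'"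
  shows "almost_disjoint (graph_image e (s h)) (graph_image e (s h'))"
proof -
  have "wo_rel \<bb>"
    using Card_order_bounding_number by (simp add: wo_rel_def card_order_on_def)
  then have "(h, h') \<in> \<bb> \<or> (h', h) \<in> \<bb>"
    using wo_rel.TOTALS assms by blast
  then have "finite {n. s h n \<le> s h' n} \<or> finite {n. s h' n \<le> s h n}"
    using scaleD(3)[OF assms(2)] assms(5) by metis
  then have "finite {n. s h n = s h' n}"
    by (elim disjE; elim rev_finite_subset) auto
  then show ?thesis
    using assms(1) by (rule almost_disjoint_graphs[rotated])
qed

lemma AD_family_columns_and_graphs:
  assumes "inj e" "scale s"
  shows "AD_family (columns_and_graphs e s)"
  unfolding AD_family_def
proof (intro conjI ballI impI)
  fix X assume "X \<in> columns_and_graphs e s"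
  then show "infinite X"
    using assms(1) infinite_column infinite_graph_image unfolding columns_and_graphs_def by blast
next
  fix X Y assume XY: "X \<in> columns_and_graphs e s" "Y \<in> columns_and_graphs e s" "X \<noteq> Y"
  show "almost_disjoint X Y"
    using XY unfolding columns_and_graphs_def
    by (elim UnE imageE)
      (metis almost_disjoint_columns[OF assms(1)] almost_disjoint_column_graph[OF assms(1)]
        almost_disjoint_scale_graphs[OF assms] almost_disjoint_sym)+
qed

text \<open>Graphs at distinct indices are distinct, since an infinite set is not almost disjoint
  from itself. This gives \<open>\<bb>\<close> many graphs, and adding countably many columns does
  not change the cardinality.\<close>

lemma card_columns_and_graphs:
  assumes "inj e" "scale s"
  shows "|columns_and_graphs e s| =o \<bb>"
proof -
  let ?G = "(\<lambda>h. graph_image e (s h)) ` Field \<bb>"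
  have inj: "inj_on (\<lambda>h. graph_image e (s h)) (Field \<bb>)"
  proof (rule inj_onI, rule ccontr)
    fix h h' assume "h \<in> Field \<bb>" "h' \<in> Field \<bb>" "h \<noteq> h'"
      and eq: "graph_image e (s h) = graph_image e (s h')"
    then have "almost_disjoint (graph_image e (s h)) (graph_image e (s h'))"
      using assms almost_disjoint_scale_graphs by blast
    then show False
      using eq infinite_graph_image[OF assms(1)] by (simp add: almost_disjoint_def)
  qed
  then have "|Field \<bb>| =o |?G|"
    by (metis bij_betw_imageI card_of_ordIsoI)
  then have G: "|?G| =o \<bb>"
    using Field_bounding_number(2) ordIso_symmetric by metis
  moreover have "|range (column e)| \<le>o \<bb>"
    by (simp add: countable_card_less_bounding_number ordLess_imp_ordLeq)
  ultimately have "|range (column e) \<union> ?G| \<le>o \<bb>"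
    using card_of_Un_ordLeq_infinite_Field infinite_Field_bounding_number
      Card_order_bounding_number ordIso_imp_ordLeq by blast
  moreover have "\<bb> \<le>o |range (column e) \<union> ?G|"
    using G card_of_mono1[of ?G "range (column e) \<union> ?G"] ordIso_symmetric
      ordIso_ordLeq_trans by blast
  ultimately show ?thesis
    unfolding columns_and_graphs_def by (simp add: ordIso_iff_ordLeq)
qed

section \<open>Refining two orthogonal towers\<close>

text \<open>The tower order is used for \<open>T1\<close> and the size for \<open>T2\<close>; the
  result is applied to the two towers in both orders.\<close>

lemma no_tower_gets_infinitely_many_columns:
  assumes e: "inj e" and s: "scale s" and A: "tower \<bb> A"
    and T1: "T1 = A ` Field \<bb>" and T2: "|T2| =o \<bb>"
    and orth: "orthogonal_families T1 T2"
    and range: "T2 \<subseteq> f ` columns_and_graphs e s"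
    and refine: "\<And>X. X \<in> columns_and_graphs e s \<Longrightarrow> X \<subseteq>\<^sup>* f X"
  shows "finite {n. f (column e n) \<in> T1}"
proof (rule ccontr)
  assume inf: "infinite {n. f (column e n) \<in> T1}" (is "infinite ?I")
  have "\<forall>n\<in>?I. \<exists>h. h \<in> Field \<bb> \<and> f (column e n) = A h"
    unfolding T1 by blast
  then obtain a where a: "\<And>n. n \<in> ?I \<Longrightarrow> a n \<in> Field \<bb> \<and> f (column e n) = A (a n)"
    by metis
  \<comment> \<open>The countably many levels \<open>a n\<close> have an upper bound
    \<open>h\<close>, so the single set \<open>A h\<close> almost contains every column assigned to
    \<open>T1\<close>.\<close>
  obtain h where h: "h \<in> Field \<bb>" "\<And>n. n \<in> ?I \<Longrightarrow> (a n, h) \<in> \<bb>"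
  proof (rule countable_bound_in_bounding_number[of "a ` ?I"])
    show "a ` ?I \<subseteq> Field \<bb>"
      using a by blast
  qed auto
  have columns: "column e n \<subseteq>\<^sup>* A h" if n: "n \<in> ?I" for n
  proof -
    have "f (column e n) \<subseteq>\<^sup>* A h"
      using A a[OF n] h(2)[OF n]
      by (cases "a n = h") (auto simp: tower_def strictly_almost_contained_def almost_contained_def)
    moreover have "column e n \<subseteq>\<^sup>* f (column e n)"
      by (rule refine) (simp add: columns_and_graphs_def)
    moreover have "column e n - A h \<subseteq> (column e n - f (column e n)) \<union> (f (column e n) - A h)"
      by blast
    ultimately show ?thesis
      unfolding almost_contained_def by (meson finite_UnI finite_subset)
  qed
  define B where "B = {h \<in> Field \<bb>. f (graph_image e (s h)) \<in> T2}"
  \<comment> \<open>Each member of \<open>T2\<close> is the value of \<open>f\<close> at a column or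
    at a graph indexed in \<open>B\<close>. Columns give countably many values and a non-cofinal
    \<open>B\<close> fewer than \<open>\<bb>\<close>, together too few for
    \<open>T2\<close>.\<close>
  have "cofinal_in \<bb> B"
  proof (rule ccontr)
    let ?C = "range (\<lambda>n. f (column e n))" and ?D = "(\<lambda>h. f (graph_image e (s h))) ` B"
    assume "\<not> cofinal_in \<bb> B"
    then have "|B| <o \<bb>"
      by (intro not_cofinal_in_card_less[OF Card_order_bounding_number]) (auto simp: B_def)
    then have "|?D| <o |Field \<bb>|"
      unfolding Field_bounding_number(2) by (rule ordLeq_ordLess_trans[OF card_of_image])
    moreover have "|?C| <o |Field \<bb>|"
      using countable_card_less_bounding_number[of ?C] Field_bounding_number(2) by simp
    ultimately have "|?C \<union> ?D| <o |Field \<bb>|"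
      by (intro card_of_Un_ordLess_infinite infinite_Field_bounding_number)
    moreover have "T2 \<subseteq> ?C \<union> ?D"
      using range unfolding columns_and_graphs_def B_def by blast
    ultimately have "|T2| <o |Field \<bb>|"
      using ordLeq_ordLess_trans[OF card_of_mono1] by blast
    then show False
      using T2 not_ordLess_ordIso unfolding Field_bounding_number(2) by blast
  qed
  then have unbounded: "unbounded_family (s ` B)"
    using s scale_cofinal_unbounded by blast
  obtain g where g: "\<And>f. almost_disjoint (A h) (graph_image e f) \<Longrightarrow> finite {n \<in> ?I. g n \<le> f n}"
    using dominated_on_columns[OF e, of ?I "A h"] columns by blast
  \<comment> \<open>The graph of \<open>s b\<close> is almost contained in a member of
    \<open>T2\<close>, which by orthogonality is almost disjoint from \<open>A h\<close>; hence so
    is the graph, and \<open>g\<close> applies.\<close>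
  have "finite {n \<in> ?I. g n \<le> s b n}" if b: "b \<in> B" for b
  proof (rule g)
    let ?X = "graph_image e (s b)"
    have "?X \<subseteq>\<^sup>* f ?X"
      using b refine unfolding B_def columns_and_graphs_def by blast
    moreover have "almost_disjoint (A h) (f ?X)"
      using orth b h(1) unfolding orthogonal_families_def T1 B_def by blast
    moreover have "A h \<inter> ?X \<subseteq> (?X - f ?X) \<union> (A h \<inter> f ?X)"
      by blast
    ultimately show "almost_disjoint (A h) ?X"
      unfolding almost_contained_def almost_disjoint_def by (meson finite_UnI finite_subset)
  qed
  moreover have "mono (s b)" for b
    using scaleD(1)[OF s] by (rule strict_mono_mono)
  ultimately have "\<not> unbounded_family (s ` B)"
    using mono_bounded_on_infinite[OF inf, of "s ` B" g] by blast
  then show False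
    using unbounded by blast
qed

lemma columns_and_graphs_not_refinement:
  assumes e: "inj e" and s: "scale s" and A: "tower \<bb> A" and C: "tower \<bb> C"
    and T1: "T1 = A ` Field \<bb>" "|T1| =o \<bb>" and T2: "T2 = C ` Field \<bb>" "|T2| =o \<bb>"
    and orth: "orthogonal_families T1 T2"
  shows "\<not> AD_refinement (columns_and_graphs e s) (T1 \<union> T2)"
proof
  assume "AD_refinement (columns_and_graphs e s) (T1 \<union> T2)"
  then obtain f where "bij_betw f (columns_and_graphs e s) (T1 \<union> T2)"
    and "\<forall>X\<in>columns_and_graphs e s. X \<subseteq>\<^sup>* f X"
    unfolding AD_refinement_def by (elim conjE exE)
  then have f: "f ` columns_and_graphs e s = T1 \<union> T2"
    and refine: "\<And>X. X \<in> columns_and_graphs e s \<Longrightarrow> X \<subseteq>\<^sup>* f X"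
    by (simp_all add: bij_betw_def)
  have "orthogonal_families T2 T1"
    using orth almost_disjoint_sym unfolding orthogonal_families_def by meson
  then have "finite {n. f (column e n) \<in> T2}"
    by (rule no_tower_gets_infinitely_many_columns[OF e s C T2(1) T1(2) _ _ refine])
      (use f in auto)
  moreover have "finite {n. f (column e n) \<in> T1}"
    by (rule no_tower_gets_infinitely_many_columns[OF e s A T1(1) T2(2) orth _ refine])
      (use f in auto)
  \<comment> \<open>Pigeonhole: each column is assigned to one of the towers, so these two finite
    sets would cover all of \<omega>.\<close>
  ultimately have "finite ({n. f (column e n) \<in> T1} \<union> {n. f (column e n) \<in> T2})"
    by simp
  moreover have "f (column e n) \<in> T1 \<union> T2" for n
    unfolding f[symmetric] columns_and_graphs_def by simp
  then have "{n. f (column e n) \<in> T1} \<union> {n. f (column e n) \<in> T2} = UNIV"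
    by auto
  ultimately show False
    by simp
qed

theorem theorem2p1:
  fixes \<Omega> :: "'a set"
  assumes "countable \<Omega>" and "infinite \<Omega>"
  shows "\<exists>Q. AD_family Q \<and> Q \<subseteq> Pow \<Omega> \<and> |Q| =o \<bb> \<and>
    (\<forall>(A :: (nat \<Rightarrow> nat) \<Rightarrow> 'a set) (C :: (nat \<Rightarrow> nat) \<Rightarrow> 'a set) T1 T2.
       T1 = A ` Field \<bb> \<and> T2 = C ` Field \<bb> \<and>
       T1 \<subseteq> Pow \<Omega> \<and> T2 \<subseteq> Pow \<Omega> \<and>
       tower \<bb> A \<and> tower \<bb> C \<and>
       |T1| =o \<bb> \<and> |T2| =o \<bb> \<and>
       orthogonal_families T1 T2 \<longrightarrow>
       \<not> AD_refinement Q (T1 \<union> T2))"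
proof -
  \<comment> \<open>An enumeration of \<open>\<Omega>\<close> composed with the pairing bijection
    makes \<open>\<Omega>\<close> a copy of \<omega> \<times> \<omega>.\<close>
  define e where "e = from_nat_into \<Omega> \<circ> prod_encode"
  have "bij_betw e UNIV \<Omega>"
    unfolding e_def using bij_prod_encode bij_betw_from_nat_into[OF assms] by (rule bij_betw_trans)
  then have e: "inj e" "range e = \<Omega>"
    by (simp_all add: bij_betw_def)
  obtain s where s: "scale s"
    using exists_scale by blast
  have "columns_and_graphs e s \<subseteq> Pow \<Omega>"
    using e(2) by (auto simp: columns_and_graphs_def column_def graph_image_def)
  moreover have "\<not> AD_refinement (columns_and_graphs e s) (T1 \<union> T2)"
    if "T1 = A ` Field \<bb> \<and> T2 = C ` Field \<bb> \<and> T1 \<subseteq> Pow \<Omega> \<and> T2 \<subseteq> Pow \<Omega> \<and>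
      tower \<bb> A \<and> tower \<bb> C \<and> |T1| =o \<bb> \<and> |T2| =o \<bb> \<and> orthogonal_families T1 T2"
    for A C T1 T2
    by (rule columns_and_graphs_not_refinement[OF e(1) s, of A C]) (use that in auto)
  ultimately show ?thesis
    using AD_family_columns_and_graphs[OF e(1) s] card_columns_and_graphs[OF e(1) s]
    by (intro exI[of _ "columns_and_graphs e s"] conjI allI impI)
qed

end
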